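(* Let $G=(V,E)$ be a finite simple graph with at least one edge, and let $\mu_0>\mu_1>\dots>\mu_m$ be all the distinct eigenvalues of problem (M) (so $\mu_m=0$). For every $k\in\{0,\dots,m\}$ and every eigenvector $\vec x_k$ of (M) with eigenvalue $\mu_k$, $N(\vec x_k)\le k$, where $N(\vec x)$ is the number of connected components with at least two vertices of the subgraph induced by $D_0(\vec x)$. In particular, for every eigenvector $\vec x_0$ with eigenvalue $\mu_0$, the subgraph induced by $D_0(\vec x_0)$ has no edges.
   Context: $V=\{1,\dots,n\}$, unit edge weights, $\mathrm{vol}(V)=\sum_i d_i$. $\mathrm{Sgn}(t)=\{1\},[-1,1],\{-1\}$ for $t>0,t=0,t<0$; $(\Delta_1\vec x)_i=\{\sum_{j:\{i,j\}\in E}z_{ij}: z_{ij}\in\mathrm{Sgn}(x_i-x_j), z_{ij}=-z_{ji}\}$. Problem (M): $(\mu,\vec x)$ with $\vec x\ne\vec 0$ and $\Delta_1\vec x\cap\mu\,\mathrm{vol}(V)\,\partial\|\vec x\|_\infty\neq\emptyset$ ($\partial$ = convex subdifferential). $D_0(\vec x)=\{i:|x_i|<\|\vec x\|_\infty\}$. *)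

theory Defs
  imports "HOL-Analysis.Analysis"
begin

text \<open>
  A finite simple graph whose vertex set is the finite type \<open>'n\<close> is given by its set \<open>E\<close> of
  edges, each edge being a two-element set of vertices.
\<close>

definition simple_graph :: "'n::finite set set \<Rightarrow> bool" where
  "simple_graph E \<longleftrightarrow> (\<forall>e\<in>E. card e = 2)"

definition degree :: "'n::finite set set \<Rightarrow> 'n \<Rightarrow> nat" where
  "degree E i = card {j. {i, j} \<in> E}"

definition vol :: "'n::finite set set \<Rightarrow> real" where
  "vol E = (\<Sum>i\<in>UNIV. real (degree E i))"

definition Sgn :: "real \<Rightarrow> real set" where
  "Sgn t = (if t > 0 then {1} else if t = 0 then {-1..1} else {-1})"

text \<open>
  One antisymmetric family \<open>z\<close> serves all coordinates at once, so \<open>Delta1 E x\<close> is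
  in general not a product of intervals.
\<close>

definition Delta1 :: "'n::finite set set \<Rightarrow> real ^ 'n \<Rightarrow> (real ^ 'n) set" where
  "Delta1 E x =
    {(\<chi> i. \<Sum>j | {i, j} \<in> E. z i j) | z :: 'n \<Rightarrow> 'n \<Rightarrow> real.
       \<forall>i j. {i, j} \<in> E \<longrightarrow> z i j \<in> Sgn (x $ i - x $ j) \<and> z i j = - z j i}"

definition subdifferential :: "('a::real_inner \<Rightarrow> real) \<Rightarrow> 'a \<Rightarrow> 'a set" where
  "subdifferential f x = {g. \<forall>y. f y \<ge> f x + g \<bullet> (y - x)}"

definition eigenpair :: "'n::finite set set \<Rightarrow> real \<Rightarrow> real ^ 'n \<Rightarrow> bool" where
  "eigenpair E \<mu> x \<longleftrightarrow>
     x \<noteq> 0 \<and> Delta1 E x \<inter> (\<lambda>g. (\<mu> * vol E) *\<^sub>R g) ` subdifferential infnorm x \<noteq> {}"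

definition eigenvalues :: "'n::finite set set \<Rightarrow> real set" where
  "eigenvalues E = {\<mu>. \<exists>x. eigenpair E \<mu> x}"

definition D0 :: "real ^ 'n::finite \<Rightarrow> 'n set" where
  "D0 x = {i. \<bar>x $ i\<bar> < infnorm x}"

definition induced_edges :: "'n::finite set set \<Rightarrow> 'n set \<Rightarrow> 'n set set" where
  "induced_edges E S = {e \<in> E. e \<subseteq> S}"

text \<open>
  Vertex sets of the connected components of the graph with vertex set \<open>S\<close> and edge set
  \<open>F\<close>: the classes of the reachability relation on \<open>S\<close>. Isolated vertices of \<open>S\<close>
  form singleton components.
\<close>

definition components_of_graph :: "'n::finite set \<Rightarrow> 'n set set \<Rightarrow> 'n set set" where
  "components_of_graph S F = S // {(i, j). {i, j} \<in> F}\<^sup>*"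

definition N :: "'n::finite set set \<Rightarrow> real ^ 'n \<Rightarrow> nat" where
  "N E x = card {C \<in> components_of_graph (D0 x) (induced_edges E (D0 x)). card C \<ge> 2}"

end

theory Submission
  imports Defs
begin

text \<open>
  A nonzero vector is an eigenvector exactly if some sign flow has zero divergence on
  \<open>D0 x\<close>: elsewhere the flow between extremal vertices of equal sign may be cancelled, and
  then the divergence has the sign of \<open>x\<close>. By convexity this means that \<open>x\<close>
  minimizes the total variation among all vectors with the same extremal coordinates, so the
  eigenvalue depends only on the sign pattern of these coordinates, and there are finitely many.
  If a component \<open>C\<close> of \<open>D0 x\<close> contains an edge \<open>{i, j}\<close>, set
  the values on \<open>C\<close> to plus or minus the norm. The flow on the other components is
  untouched, so this is again an eigenvector. Its eigenvalue is not smaller by minimality, and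
  it is strictly larger for at least one choice of the signs at \<open>i\<close> and
  \<open>j\<close>, since unequal signs have larger total variation on average than equal ones.
  Thus removing one component costs one step up in the spectrum.
\<close>

section \<open>Extremal and non-extremal coordinates\<close>

lemma infnorm_vec_eqI:
  fixes x :: "real ^ 'n"
  assumes "\<And>i. \<bar>x $ i\<bar> \<le> s" and "\<bar>x $ k\<bar> = s"
  shows "infnorm x = s"
  unfolding infnorm_cart by (rule cSup_eq_maximum) (use assms in auto)

lemma infnorm_attained:
  fixes x :: "real ^ 'n"
  obtains k where "\<bar>x $ k\<bar> = infnorm x"
proof -
  have "Max (range (\<lambda>i. \<bar>x $ i\<bar>)) \<in> range (\<lambda>i. \<bar>x $ i\<bar>)"
    by (rule Max_in) auto
  then obtain k where k: "\<bar>x $ k\<bar> = Max (range (\<lambda>i. \<bar>x $ i\<bar>))"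
    by force
  have "infnorm x = Max (range (\<lambda>i. \<bar>x $ i\<bar>))"
    by (rule infnorm_vec_eqI[OF _ k]) simp
  with k that show thesis by simp
qed

lemma notin_D0_iff: "i \<notin> D0 x \<longleftrightarrow> \<bar>x $ i\<bar> = infnorm x"
  using component_le_infnorm_cart[of x i] by (auto simp: D0_def)

text \<open>Equality case of Hoelder's inequality, one coordinate at a time; applied to subgradients
  and to outflows.\<close>

lemma mult_nth_eq_abs_mult_infnorm:
  fixes x :: "real ^ 'n"
  assumes "i \<in> D0 x \<Longrightarrow> a = 0" and "i \<notin> D0 x \<Longrightarrow> a * x $ i \<ge> 0"
  shows "a * x $ i = \<bar>a\<bar> * infnorm x"
proof (cases "i \<in> D0 x")
  case False
  then have "\<bar>x $ i\<bar> = infnorm x" by (simp add: notin_D0_iff)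
  then show ?thesis using assms(2)[OF False] by (metis abs_mult abs_of_nonneg)
qed (simp add: assms(1))

subsection \<open>Subgradients of the maximum norm\<close>

text \<open>Euler's identity for a positively homogeneous convex function: the tests at
  \<open>0\<close> and at twice \<open>x\<close> give the two inequalities.\<close>

lemma subgradient_infnorm_inner:
  assumes "g \<in> subdifferential infnorm x"
  shows "g \<bullet> x = infnorm x"
proof -
  have "infnorm y \<ge> infnorm x + g \<bullet> (y - x)" for y
    using assms by (auto simp: subdifferential_def)
  from this[of 0] this[of "2 *\<^sub>R x"] show ?thesis
    by (simp add: infnorm_mul infnorm_0 algebra_simps)
qed

text \<open>A non-extremal coordinate can move a little both ways without changing the norm, which
  another coordinate attains.\<close>

lemma subgradient_infnorm_D0:
  fixes x :: "real ^ 'n"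
  assumes g: "g \<in> subdifferential infnorm x" and i: "i \<in> D0 x"
  shows "g $ i = 0"
proof -
  define e where "e = infnorm x - \<bar>x $ i\<bar>"
  have e: "e > 0" using i by (simp add: D0_def e_def)
  obtain k where k: "\<bar>x $ k\<bar> = infnorm x" by (rule infnorm_attained)
  have "g $ i * t \<le> 0" if t: "\<bar>t\<bar> \<le> e" for t
  proof -
    let ?y = "x + t *\<^sub>R axis i 1"
    have "k \<noteq> i" using i k by (auto simp: D0_def)
    then have "infnorm ?y = infnorm x"
      using t k component_le_infnorm_cart[of x]
      by (intro infnorm_vec_eqI[where k = k]) (auto simp: axis_def e_def)
    moreover have "infnorm ?y \<ge> infnorm x + g \<bullet> (?y - x)"
      using g unfolding subdifferential_def by blast
    ultimately show ?thesis by (simp add: inner_axis mult.commute)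
  qed
  from this[of e] this[of "- e"] e show ?thesis
    by (simp add: mult_le_0_iff zero_le_mult_iff)
qed

text \<open>The dual norm is the l1 norm: a \<open>g\<close> of dual norm 1 that pairs with
  \<open>x\<close> to \<open>infnorm x\<close> is a subgradient, and the sign conditions force this
  pairing.\<close>

lemma infnorm_subgradientI:
  fixes x g :: "real ^ 'n"
  assumes "\<And>i. i \<in> D0 x \<Longrightarrow> g $ i = 0" and "\<And>i. i \<notin> D0 x \<Longrightarrow> g $ i * x $ i \<ge> 0"
    and "(\<Sum>i\<in>UNIV. \<bar>g $ i\<bar>) = 1"
  shows "g \<in> subdifferential infnorm x"
proof -
  have "g $ i * x $ i = \<bar>g $ i\<bar> * infnorm x" for i
    using assms(1,2) by (rule mult_nth_eq_abs_mult_infnorm)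
  then have gx: "g \<bullet> x = infnorm x"
    using assms(3) by (simp add: inner_vec_def flip: sum_distrib_right)
  have "g \<bullet> y \<le> infnorm y" for y
  proof -
    have "g $ i * y $ i \<le> \<bar>g $ i\<bar> * infnorm y" for i
    proof -
      have "g $ i * y $ i \<le> \<bar>g $ i\<bar> * \<bar>y $ i\<bar>"
        by (simp flip: abs_mult)
      also have "\<dots> \<le> \<bar>g $ i\<bar> * infnorm y"
        by (intro mult_left_mono component_le_infnorm_cart) auto
      finally show ?thesis .
    qed
    then have "g \<bullet> y \<le> (\<Sum>i\<in>UNIV. \<bar>g $ i\<bar> * infnorm y)"
      unfolding inner_vec_def by (auto intro: sum_mono)
    then show ?thesis using assms(3) by (simp flip: sum_distrib_right)
  qed
  then show ?thesis by (simp add: subdifferential_def inner_diff_right gx)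
qed

lemma subdifferential_infnorm_nonempty:
  fixes x :: "real ^ 'n"
  shows "subdifferential infnorm x \<noteq> {}"
proof -
  obtain k where k: "\<bar>x $ k\<bar> = infnorm x" by (rule infnorm_attained)
  define g :: "real ^ 'n" where "g = axis k (if x $ k \<ge> 0 then 1 else - 1)"
  have "g \<in> subdifferential infnorm x"
  proof (rule infnorm_subgradientI)
    have "\<bar>g $ i\<bar> = (if i = k then 1 else 0)" for i
      by (simp add: g_def axis_def)
    then show "(\<Sum>i\<in>UNIV. \<bar>g $ i\<bar>) = 1" by simp
  qed (use k in \<open>auto simp: g_def axis_def D0_def\<close>)
  then show ?thesis by blast
qed

subsection \<open>Sign flows and total variation\<close>

definition sign_flow :: "'n::finite set set \<Rightarrow> real ^ 'n \<Rightarrow> ('n \<Rightarrow> 'n \<Rightarrow> real) \<Rightarrow> bool" where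
  "sign_flow E x z \<longleftrightarrow>
     (\<forall>i j. {i, j} \<in> E \<longrightarrow> z i j \<in> Sgn (x $ i - x $ j) \<and> z i j = - z j i)"

definition outflow :: "'n::finite set set \<Rightarrow> ('n \<Rightarrow> 'n \<Rightarrow> real) \<Rightarrow> 'n \<Rightarrow> real" where
  "outflow E z i = (\<Sum>j | {i, j} \<in> E. z i j)"

text \<open>Every edge is counted in both directions.\<close>

definition total_variation :: "'n::finite set set \<Rightarrow> real ^ 'n \<Rightarrow> real" where
  "total_variation E x = (\<Sum>i\<in>UNIV. \<Sum>j | {i, j} \<in> E. \<bar>x $ i - x $ j\<bar>)"

text \<open>The eigenvector condition freed of the eigenvalue; \<open>eigenpairD\<close> and
  \<open>critical_imp_eigenpair\<close> show that it characterizes eigenvectors among nonzero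
  vectors when the volume is positive.\<close>

definition critical :: "'n::finite set set \<Rightarrow> real ^ 'n \<Rightarrow> bool" where
  "critical E x \<longleftrightarrow> (\<exists>z. sign_flow E x z \<and> (\<forall>i\<in>D0 x. outflow E z i = 0))"

lemma Delta1_eq: "Delta1 E x = {(\<chi> i. outflow E z i) | z. sign_flow E x z}"
  by (simp add: Delta1_def sign_flow_def outflow_def)

lemma sign_flow_Sgn: "sign_flow E x z \<Longrightarrow> {i, j} \<in> E \<Longrightarrow> z i j \<in> Sgn (x $ i - x $ j)"
  unfolding sign_flow_def by blast

lemma sign_flow_antisym: "sign_flow E x z \<Longrightarrow> {i, j} \<in> E \<Longrightarrow> z i j = - z j i"
  unfolding sign_flow_def by blast

text \<open>Discrete Green formula: exchanging the endpoints turns the \<open>w $ j\<close> part, by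
  antisymmetry, into the negative of the \<open>w $ i\<close> part, hence the factor 2.\<close>

lemma flow_summation_by_parts:
  fixes w :: "real ^ 'n"
  assumes "sign_flow E x z"
  shows "(\<Sum>i\<in>UNIV. \<Sum>j | {i, j} \<in> E. z i j * (w $ i - w $ j)) =
    2 * (\<Sum>i\<in>UNIV. outflow E z i * w $ i)"
proof -
  have "(\<Sum>i\<in>UNIV. \<Sum>j | {i, j} \<in> E. z i j * w $ j) =
      (\<Sum>j\<in>UNIV. \<Sum>i | {i, j} \<in> E. z i j * w $ j)"
    using sum.swap_restrict[of UNIV UNIV "\<lambda>i j. z i j * w $ j" "\<lambda>i j. {i, j} \<in> E"] by simp
  also have "\<dots> = (\<Sum>j\<in>UNIV. \<Sum>i | {j, i} \<in> E. - (z j i * w $ j))"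
  proof (intro sum.cong refl)
    fix i j assume "i \<in> {i. {j, i} \<in> E}"
    then have "z i j = - z j i"
      using sign_flow_antisym[OF assms, of i j] by (simp add: insert_commute)
    then show "z i j * w $ j = - (z j i * w $ j)" by simp
  qed (simp add: insert_commute)
  finally show ?thesis
    by (simp add: outflow_def right_diff_distrib sum_subtractf sum_negf sum_distrib_right)
qed

lemma total_variation_eq_outflow:
  assumes "sign_flow E x z"
  shows "total_variation E x = 2 * (\<Sum>i\<in>UNIV. outflow E z i * x $ i)"
proof -
  have "\<bar>x $ i - x $ j\<bar> = z i j * (x $ i - x $ j)" if "{i, j} \<in> E" for i j
  proof -
    have "z i j \<in> Sgn (x $ i - x $ j)" using assms that by (rule sign_flow_Sgn)
    then show ?thesis by (auto simp: Sgn_def split: if_splits)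
  qed
  then show ?thesis
    unfolding total_variation_def flow_summation_by_parts[OF assms, symmetric]
    by (intro sum.cong) auto
qed

text \<open>Flow values are at most 1 in absolute value. With the equality at \<open>x\<close>, this
  makes twice the outflow a subgradient of the total variation at \<open>x\<close>.\<close>

lemma total_variation_ge_outflow:
  assumes "sign_flow E x z"
  shows "total_variation E y \<ge> 2 * (\<Sum>i\<in>UNIV. outflow E z i * y $ i)"
proof -
  have "\<bar>y $ i - y $ j\<bar> \<ge> z i j * (y $ i - y $ j)" if "{i, j} \<in> E" for i j
  proof -
    have "z i j \<in> Sgn (x $ i - x $ j)" using assms that by (rule sign_flow_Sgn)
    then have "\<bar>z i j\<bar> \<le> 1" by (auto simp: Sgn_def split: if_splits)
    then have "\<bar>z i j * (y $ i - y $ j)\<bar> \<le> 1 * \<bar>y $ i - y $ j\<bar>"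
      unfolding abs_mult by (rule mult_right_mono) auto
    then show ?thesis by simp
  qed
  then show ?thesis
    unfolding total_variation_def flow_summation_by_parts[OF assms, symmetric]
    by (intro sum_mono) auto
qed

text \<open>The outflow vanishes wherever \<open>y\<close> may differ from \<open>x\<close>, so the
  lower bound at \<open>y\<close> equals the value at \<open>x\<close>.\<close>

lemma critical_minimizes_total_variation:
  assumes "critical E x" and "\<And>i. i \<notin> D0 x \<Longrightarrow> y $ i = x $ i"
  shows "total_variation E x \<le> total_variation E y"
proof -
  obtain z where z: "sign_flow E x z" "\<And>i. i \<in> D0 x \<Longrightarrow> outflow E z i = 0"
    using assms(1) by (auto simp: critical_def)
  have "(\<Sum>i\<in>UNIV. outflow E z i * x $ i) = (\<Sum>i\<in>UNIV. outflow E z i * y $ i)"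
    by (rule sum.cong) (use z(2) assms(2) in \<open>auto, metis\<close>)
  with total_variation_eq_outflow[OF z(1)] total_variation_ge_outflow[OF z(1), of y]
  show ?thesis by simp
qed

lemma total_variation_scaleR: "c \<ge> 0 \<Longrightarrow> total_variation E (c *\<^sub>R x) = c * total_variation E x"
  by (simp add: total_variation_def sum_distrib_left abs_mult flip: right_diff_distrib)

subsection \<open>Eigenpairs\<close>

lemma vol_pos:
  assumes "simple_graph E" and "E \<noteq> {}"
  shows "vol E > 0"
proof -
  obtain e where "e \<in> E" "card e = 2" using assms by (auto simp: simple_graph_def)
  then obtain i j where "{i, j} \<in> E" by (auto simp: card_2_iff)
  then have "degree E i > 0" by (auto simp: degree_def card_gt_0_iff)
  then show ?thesis unfolding vol_def by (intro sum_pos2[where i = i]) auto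
qed

text \<open>Pairing the inclusion with \<open>x\<close> eliminates the subgradient and leaves a
  formula for the eigenvalue.\<close>

lemma eigenpairD:
  assumes "eigenpair E \<mu> x"
  shows "critical E x" and "total_variation E x = 2 * \<mu> * vol E * infnorm x"
proof -
  obtain z g where z: "sign_flow E x z" and g: "g \<in> subdifferential infnorm x"
    and eq: "(\<chi> i. outflow E z i) = (\<mu> * vol E) *\<^sub>R g"
    using assms unfolding eigenpair_def Delta1_eq by blast
  from eq have out: "outflow E z i = \<mu> * vol E * g $ i" for i
    by (simp add: vec_eq_iff)
  show "critical E x"
    unfolding critical_def using z out subgradient_infnorm_D0[OF g] by auto
  have "(\<Sum>i\<in>UNIV. outflow E z i * x $ i) = \<mu> * vol E * (g \<bullet> x)"
    by (simp add: out inner_vec_def sum_distrib_left mult.assoc)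
  then show "total_variation E x = 2 * \<mu> * vol E * infnorm x"
    using total_variation_eq_outflow[OF z] subgradient_infnorm_inner[OF g] by simp
qed

text \<open>Converse of \<open>eigenpairD\<close>: a suitable outflow, divided by its l1 norm
  \<open>c\<close>, is a subgradient, and pairing with \<open>x\<close> identifies \<open>c\<close>
  as eigenvalue times volume.\<close>

lemma critical_imp_eigenpair:
  assumes "critical E x" and "x \<noteq> 0" and "vol E > 0"
  shows "eigenpair E (total_variation E x / (2 * vol E * infnorm x)) x"
proof -
  obtain z where z: "sign_flow E x z" "\<And>i. i \<in> D0 x \<Longrightarrow> outflow E z i = 0"
    using assms(1) by (auto simp: critical_def)
  txt \<open>
    Cancelling the flow between extremal vertices of equal sign makes the outflow point in the
    direction of \<open>x\<close> at every extremal vertex.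
  \<close>
  define z' where "z' i j = (if i \<notin> D0 x \<and> j \<notin> D0 x \<and> x $ i = x $ j then 0 else z i j)" for i j
  have z': "sign_flow E x z'"
    unfolding sign_flow_def
  proof (intro allI impI)
    fix i j assume "{i, j} \<in> E"
    with sign_flow_Sgn[OF z(1) this] sign_flow_antisym[OF z(1) this]
    show "z' i j \<in> Sgn (x $ i - x $ j) \<and> z' i j = - z' j i"
      by (cases "i \<notin> D0 x \<and> j \<notin> D0 x \<and> x $ i = x $ j") (auto simp: z'_def Sgn_def)
  qed
  define u where "u = (\<chi> i. outflow E z' i)"
  define c where "c = (\<Sum>i\<in>UNIV. \<bar>u $ i\<bar>)"
  have s: "infnorm x > 0" using assms(2) by (simp add: infnorm_pos_lt)
  have u_D0: "u $ i = 0" if "i \<in> D0 x" for i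
    using z(2)[OF that] that by (simp add: u_def outflow_def z'_def)
  have u_sign: "u $ i * x $ i \<ge> 0" if i: "i \<notin> D0 x" for i
  proof -
    have xi: "\<bar>x $ i\<bar> = infnorm x" using i by (simp add: notin_D0_iff)
    \<comment> \<open>A value different from the extremal \<open>x $ i\<close> can only lie on its
      inner side, so the flow carries the sign of \<open>x $ i\<close>.\<close>
    have "z' i j * x $ i \<ge> 0" if "{i, j} \<in> E" for j
    proof (cases "x $ i = x $ j")
      case True
      then have "j \<notin> D0 x" using xi by (simp add: notin_D0_iff)
      then show ?thesis using True i by (simp add: z'_def)
    next
      case False
      have "z' i j \<in> Sgn (x $ i - x $ j)" using z' that by (rule sign_flow_Sgn)
      then show ?thesis
        using False xi component_le_infnorm_cart[of x j]
        by (auto simp: Sgn_def abs_if split: if_splits)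
    qed
    then show ?thesis
      by (auto simp: u_def outflow_def sum_distrib_right intro!: sum_nonneg)
  qed
  have "u $ i * x $ i = \<bar>u $ i\<bar> * infnorm x" for i
    using u_D0 u_sign by (rule mult_nth_eq_abs_mult_infnorm)
  then have "total_variation E x = 2 * c * infnorm x"
    using total_variation_eq_outflow[OF z'] by (simp add: u_def c_def sum_distrib_right)
  then have mu: "total_variation E x / (2 * vol E * infnorm x) * vol E = c"
    using s assms(3) by simp
  have "\<exists>g\<in>subdifferential infnorm x. u = c *\<^sub>R g"
  proof (cases "c = 0")
    \<comment> \<open>A vanishing outflow cannot be normalized, but then the factor is 0 and any
      subgradient serves.\<close>
    case True
    then have "u = 0" by (simp add: c_def sum_nonneg_eq_0_iff vec_eq_iff)
    then show ?thesis using True subdifferential_infnorm_nonempty[of x] by auto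
  next
    case False
    moreover have "c \<ge> 0" by (simp add: c_def sum_nonneg)
    ultimately have c: "c > 0" by simp
    have "(1 / c) *\<^sub>R u \<in> subdifferential infnorm x"
    proof (rule infnorm_subgradientI)
      show "(\<Sum>i\<in>UNIV. \<bar>((1 / c) *\<^sub>R u) $ i\<bar>) = 1"
        using c by (simp add: abs_mult c_def flip: sum_divide_distrib)
    qed (use u_D0 u_sign c in auto)
    then show ?thesis using c by (intro bexI[of _ "(1 / c) *\<^sub>R u"]) auto
  qed
  then show ?thesis
    using z' assms(2) unfolding eigenpair_def mu Delta1_eq u_def by blast
qed

lemma zero_eigenvalue: "0 \<in> eigenvalues (E :: 'n::finite set set)"
proof -
  define x :: "real ^ 'n" where "x = (\<chi> i. 1)"
  have "x \<noteq> 0" by (simp add: x_def vec_eq_iff)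
  moreover obtain g where "g \<in> subdifferential infnorm x"
    using subdifferential_infnorm_nonempty by blast
  moreover have "0 \<in> Delta1 E x"
    unfolding Delta1_eq by (auto simp: sign_flow_def outflow_def x_def Sgn_def vec_eq_iff
        intro!: exI[of _ "\<lambda>_ _. 0"])
  ultimately have "eigenpair E 0 x" unfolding eigenpair_def by force
  then show ?thesis by (auto simp: eigenvalues_def)
qed

lemma eigenvalue_nonneg:
  assumes "\<mu> \<in> eigenvalues E" and "vol E > 0"
  shows "\<mu> \<ge> 0"
proof -
  obtain x where x: "eigenpair E \<mu> x" using assms(1) by (auto simp: eigenvalues_def)
  then have "infnorm x > 0" by (simp add: eigenpair_def infnorm_pos_lt)
  moreover have "total_variation E x \<ge> 0" by (simp add: total_variation_def sum_nonneg)
  ultimately show ?thesis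
    using eigenpairD(2)[OF x] assms(2) by (simp add: zero_le_mult_iff)
qed

section \<open>Finiteness of the spectrum\<close>

definition extremal_pattern :: "real ^ 'n \<Rightarrow> 'n set \<times> 'n set" where
  "extremal_pattern x = ({i. x $ i = infnorm x}, {i. x $ i = - infnorm x})"

text \<open>Rescaled to the norm of \<open>x\<close>, the vector \<open>y\<close> competes with
  \<open>x\<close> for minimal total variation. Exchanging the roles of \<open>x\<close> and
  \<open>y\<close> gives equality.\<close>

lemma eigenvalue_le_of_pattern:
  assumes x: "eigenpair E \<mu> x" and y: "eigenpair E \<nu> y" and "vol E > 0"
    and pat: "extremal_pattern x = extremal_pattern y"
  shows "\<mu> \<le> \<nu>"
proof -
  have s: "infnorm x > 0" "infnorm y > 0"
    using x y by (simp_all add: eigenpair_def infnorm_pos_lt)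
  let ?c = "infnorm x / infnorm y"
  have "(?c *\<^sub>R y) $ i = x $ i" if "i \<notin> D0 x" for i
  proof -
    have "x $ i = infnorm x \<or> x $ i = - infnorm x"
      using that unfolding notin_D0_iff by linarith
    moreover have "x $ i = infnorm x \<longleftrightarrow> y $ i = infnorm y"
      "x $ i = - infnorm x \<longleftrightarrow> y $ i = - infnorm y"
      using pat by (auto simp: extremal_pattern_def set_eq_iff)
    ultimately show ?thesis using s by auto
  qed
  from critical_minimizes_total_variation[OF eigenpairD(1)[OF x] this]
  have "total_variation E x \<le> ?c * total_variation E y"
    using s by (simp add: total_variation_scaleR)
  then have "2 * \<mu> * vol E * infnorm x \<le> 2 * \<nu> * vol E * infnorm x"
    unfolding eigenpairD(2)[OF x] eigenpairD(2)[OF y] using s by (simp add: field_simps)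
  then show ?thesis using s assms(3) by simp
qed

lemma finite_eigenvalues:
  fixes E :: "'n::finite set set"
  assumes "vol E > 0"
  shows "finite (eigenvalues E)"
proof -
  define ev where "ev \<mu> = (SOME x. eigenpair E \<mu> x)" for \<mu>
  have ev: "eigenpair E \<mu> (ev \<mu>)" if "\<mu> \<in> eigenvalues E" for \<mu>
    using that unfolding eigenvalues_def ev_def by (auto intro: someI)
  have "inj_on (\<lambda>\<mu>. extremal_pattern (ev \<mu>)) (eigenvalues E)"
    by (rule inj_onI) (metis ev eigenvalue_le_of_pattern assms order_antisym)
  then show ?thesis by (rule finite_imageD[rotated]) simp
qed

subsection \<open>Pushing a component of the interior set to the extremes\<close>

text \<open>An edge from \<open>i\<close> or \<open>j\<close> to a third vertex contributes equally
  to both sides, since each side uses both signs once at each of the two. The edge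
  \<open>{i, j}\<close> contributes only on the right.\<close>

lemma total_variation_flip_pair:
  fixes y :: "real \<Rightarrow> real \<Rightarrow> real ^ 'n"
  assumes y: "\<And>a b k. y a b $ k = (if k = i then a else if k = j then b else w k)"
    and "i \<noteq> j" "{i, j} \<in> E" "s > 0"
  shows "total_variation E (y s s) + total_variation E (y (- s) (- s)) <
    total_variation E (y s (- s)) + total_variation E (y (- s) s)"
proof -
  have le: "\<bar>y s s $ k - y s s $ l\<bar> + \<bar>y (- s) (- s) $ k - y (- s) (- s) $ l\<bar> \<le>
      \<bar>y s (- s) $ k - y s (- s) $ l\<bar> + \<bar>y (- s) s $ k - y (- s) s $ l\<bar>" for k l
    unfolding y by auto
  have "(\<Sum>k\<in>UNIV. \<Sum>l | {k, l} \<in> E.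
        \<bar>y s s $ k - y s s $ l\<bar> + \<bar>y (- s) (- s) $ k - y (- s) (- s) $ l\<bar>) <
      (\<Sum>k\<in>UNIV. \<Sum>l | {k, l} \<in> E.
        \<bar>y s (- s) $ k - y s (- s) $ l\<bar> + \<bar>y (- s) s $ k - y (- s) s $ l\<bar>)"
  proof (rule sum_strict_mono_ex1)
    show "\<exists>k\<in>UNIV. (\<Sum>l | {k, l} \<in> E.
        \<bar>y s s $ k - y s s $ l\<bar> + \<bar>y (- s) (- s) $ k - y (- s) (- s) $ l\<bar>) <
      (\<Sum>l | {k, l} \<in> E.
        \<bar>y s (- s) $ k - y s (- s) $ l\<bar> + \<bar>y (- s) s $ k - y (- s) s $ l\<bar>)"
    proof (rule bexI[of _ i], rule sum_strict_mono_ex1)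
      show "\<exists>l\<in>{l. {i, l} \<in> E}.
          \<bar>y s s $ i - y s s $ l\<bar> + \<bar>y (- s) (- s) $ i - y (- s) (- s) $ l\<bar> <
          \<bar>y s (- s) $ i - y s (- s) $ l\<bar> + \<bar>y (- s) s $ i - y (- s) s $ l\<bar>"
        using assms(2-4) by (intro bexI[of _ j]) (auto simp: y)
    qed (use le in auto)
  qed (auto intro!: sum_mono le)
  then show ?thesis by (simp add: total_variation_def sum.distrib)
qed

text \<open>By \<open>closed\<close>, the remaining interior vertices have no neighbours in
  \<open>C\<close>, so their outflow survives any change on \<open>C\<close>. The edge
  \<open>{i, j}\<close> gives the strict increase.\<close>

lemma raise_component:
  assumes x: "critical E x" "x \<noteq> 0"
    and C: "C \<subseteq> D0 x" "i \<in> C" "j \<in> C" "i \<noteq> j" "{i, j} \<in> E"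
    and closed: "\<And>k l. k \<in> C \<Longrightarrow> l \<in> D0 x \<Longrightarrow> {k, l} \<in> E \<Longrightarrow> l \<in> C"
  obtains y where "critical E y" "y \<noteq> 0" "infnorm y = infnorm x" "D0 y = D0 x - C"
    "total_variation E x < total_variation E y"
proof -
  define s where "s = infnorm x"
  have s: "s > 0" using x(2) by (simp add: s_def infnorm_pos_lt)
  define y where "y a b = (\<chi> k. if k = i then a else if k = j then b else if k \<in> C then s else x $ k)"
    for a b
  have y: "y a b $ k = (if k = i then a else if k = j then b else if k \<in> C then s else x $ k)"
    for a b k by (simp add: y_def)
  have out: "y a b $ k = x $ k" if "k \<notin> C" for a b k
    using that C by (auto simp: y)
  have min: "total_variation E x \<le> total_variation E (y a b)" for a b
    using C(1) by (intro critical_minimizes_total_variation[OF x(1)] out) auto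
  \<comment> \<open>By minimality the two equal-sign choices sum to at least twice the value at
    \<open>x\<close>; the two mixed choices sum to more, so one of them exceeds it.\<close>
  have "total_variation E x < total_variation E (y s (- s)) \<or>
      total_variation E x < total_variation E (y (- s) s)"
    using total_variation_flip_pair[of y i j, OF y C(4,5) s] min[of s s] min[of "- s" "- s"]
    by linarith
  then obtain a b where ab: "\<bar>a\<bar> = s" "\<bar>b\<bar> = s"
    and less: "total_variation E x < total_variation E (y a b)"
    using s by (metis abs_minus_cancel abs_of_pos)
  let ?y = "y a b"
  have onC: "\<bar>?y $ k\<bar> = s" if "k \<in> C" for k
    using that ab s by (simp add: y)
  have norm: "infnorm ?y = infnorm x"
    unfolding s_def[symmetric]
  proof (rule infnorm_vec_eqI)
    show "\<bar>?y $ k\<bar> \<le> s" for k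
      using onC[of k] out[of k a b] component_le_infnorm_cart[of x k]
      by (cases "k \<in> C") (auto simp: s_def)
  qed (rule onC[OF C(2)])
  have D0: "D0 ?y = D0 x - C"
  proof (rule set_eqI)
    show "k \<in> D0 ?y \<longleftrightarrow> k \<in> D0 x - C" for k
      using onC[of k] out[of k a b] by (cases "k \<in> C") (auto simp: D0_def norm s_def)
  qed
  have "critical E ?y"
  proof -
    obtain z where z: "sign_flow E x z" "\<And>k. k \<in> D0 x \<Longrightarrow> outflow E z k = 0"
      using x(1) by (auto simp: critical_def)
    txt \<open>No edge joins \<open>D0 y\<close> to \<open>C\<close>, so the flow needs adjusting only away from \<open>D0 y\<close>.\<close>
    define z' where "z' k l = (if k \<in> D0 ?y \<or> l \<in> D0 ?y then z k l else sgn (?y $ k - ?y $ l))"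
      for k l
    have eq: "?y $ k = x $ k \<and> ?y $ l = x $ l"
      if "{k, l} \<in> E" "k \<in> D0 ?y \<or> l \<in> D0 ?y" for k l
      using that closed[of k l] closed[of l k] out[of k a b] out[of l a b] C(1)
      unfolding D0 by (auto simp: insert_commute)
    have "sign_flow E ?y z'"
      unfolding sign_flow_def
    proof (intro allI impI)
      fix k l assume kl: "{k, l} \<in> E"
      show "z' k l \<in> Sgn (?y $ k - ?y $ l) \<and> z' k l = - z' l k"
      proof (cases "k \<in> D0 ?y \<or> l \<in> D0 ?y")
        case True
        then have "z' k l = z k l" "z' l k = z l k" by (auto simp: z'_def)
        then show ?thesis
          using sign_flow_Sgn[OF z(1) kl] sign_flow_antisym[OF z(1) kl] eq[OF kl True] by simp
      next
        case False
        then show ?thesis by (simp add: z'_def Sgn_def sgn_if)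
      qed
    qed
    moreover have "outflow E z' k = 0" if "k \<in> D0 ?y" for k
      using z(2)[of k] that D0 by (simp add: outflow_def z'_def)
    ultimately show ?thesis by (auto simp: critical_def)
  qed
  moreover have "?y \<noteq> 0" using norm s by (auto simp: s_def infnorm_0)
  ultimately show thesis using norm D0 less that by blast
qed

section \<open>Components of induced subgraphs\<close>

definition adjacency :: "'n set set \<Rightarrow> 'n set \<Rightarrow> ('n \<times> 'n) set" where
  "adjacency E S = {(i, j). {i, j} \<in> E \<and> i \<in> S \<and> j \<in> S}"

lemma components_of_graph_induced:
  "components_of_graph S (induced_edges E S) = (\<lambda>i. (adjacency E S)\<^sup>* `` {i}) ` S"
proof -
  have "{(i, j). {i, j} \<in> induced_edges E S} = adjacency E S"
    by (auto simp: induced_edges_def adjacency_def)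
  then show ?thesis by (auto simp: components_of_graph_def quotient_def)
qed

lemma adjacency_sym: "(i, j) \<in> (adjacency E S)\<^sup>* \<Longrightarrow> (j, i) \<in> (adjacency E S)\<^sup>*"
proof -
  have "sym (adjacency E S)" by (auto simp: sym_def adjacency_def insert_commute)
  then show "(i, j) \<in> (adjacency E S)\<^sup>* \<Longrightarrow> (j, i) \<in> (adjacency E S)\<^sup>*"
    by (meson sym_rtrancl symD)
qed

lemma adjacency_stays: "(i, j) \<in> (adjacency E S)\<^sup>* \<Longrightarrow> i \<in> S \<Longrightarrow> j \<in> S"
  by (induction rule: rtrancl_induct) (auto simp: adjacency_def)

text \<open>Distinct components are disjoint, so paths inside \<open>B\<close> avoid
  \<open>C\<close> and survive its deletion, while deletion creates no new connections.\<close>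

lemma components_of_graph_diff:
  assumes C: "C \<in> components_of_graph S (induced_edges E S)"
  shows "components_of_graph S (induced_edges E S) - {C} \<subseteq>
    components_of_graph (S - C) (induced_edges E (S - C))"
proof
  fix B assume B: "B \<in> components_of_graph S (induced_edges E S) - {C}"
  then obtain i where i: "i \<in> S" "B = (adjacency E S)\<^sup>* `` {i}"
    by (auto simp: components_of_graph_induced)
  obtain c where c: "c \<in> S" "C = (adjacency E S)\<^sup>* `` {c}"
    using C by (auto simp: components_of_graph_induced)
  have disj: "j \<notin> C" if "j \<in> B" for j
  proof
    assume "j \<in> C"
    with that i c have "(i, j) \<in> (adjacency E S)\<^sup>*" "(c, j) \<in> (adjacency E S)\<^sup>*" by auto
    then have "(i, c) \<in> (adjacency E S)\<^sup>*" "(c, i) \<in> (adjacency E S)\<^sup>*"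
      by (meson adjacency_sym rtrancl_trans)+
    then have "B = C" unfolding i c by (auto intro: rtrancl_trans)
    with B show False by simp
  qed
  have "(i, j) \<in> (adjacency E (S - C))\<^sup>*" if "(i, j) \<in> (adjacency E S)\<^sup>*" for j
    using that
  proof (induction rule: rtrancl_induct)
    case (step k l)
    then have "k \<in> B" "l \<in> B" using i by auto
    then have "(k, l) \<in> adjacency E (S - C)"
      using step.hyps(2) disj by (auto simp: adjacency_def)
    with step.IH show ?case by simp
  qed simp
  moreover have "adjacency E (S - C) \<subseteq> adjacency E S" by (auto simp: adjacency_def)
  then have "(adjacency E (S - C))\<^sup>* \<subseteq> (adjacency E S)\<^sup>*" by (rule rtrancl_mono)
  ultimately have "B = (adjacency E (S - C))\<^sup>* `` {i}" using i by blast
  moreover have "i \<in> S - C" using i disj by auto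
  ultimately show "B \<in> components_of_graph (S - C) (induced_edges E (S - C))"
    by (auto simp: components_of_graph_induced)
qed

text \<open>The edge is the first one on a path from a representative to another vertex of
  \<open>C\<close>.\<close>

lemma component_has_edge:
  assumes "simple_graph E" "C \<in> components_of_graph S (induced_edges E S)" "card C \<ge> 2"
  obtains i j where "i \<in> C" "j \<in> C" "i \<noteq> j" "{i, j} \<in> E"
proof -
  obtain c where c: "c \<in> S" "C = (adjacency E S)\<^sup>* `` {c}"
    using assms(2) by (auto simp: components_of_graph_induced)
  have "\<not> C \<subseteq> {c}"
    using assms(3) card_mono[of "{c}" C] by auto
  then obtain d where "(c, d) \<in> (adjacency E S)\<^sup>*" "d \<noteq> c" using c by auto
  then obtain e where e: "(c, e) \<in> adjacency E S" by (auto elim: converse_rtranclE)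
  then have "{c, e} \<in> E" by (simp add: adjacency_def)
  moreover from this have "c \<noteq> e" using assms(1) by (auto simp: simple_graph_def)
  moreover have "c \<in> C" "e \<in> C" using c e by auto
  ultimately show thesis using that by blast
qed

section \<open>Climbing the spectrum\<close>

lemma larger_eigenvalue:
  assumes "simple_graph E" "E \<noteq> {}" and x: "eigenpair E \<mu> x" and "N E x > 0"
  obtains \<nu> y where "eigenpair E \<nu> y" "\<mu> < \<nu>" "N E x \<le> Suc (N E y)"
proof -
  let ?big = "\<lambda>S. {C \<in> components_of_graph S (induced_edges E S). card C \<ge> 2}"
  have vol: "vol E > 0" using assms(1,2) by (rule vol_pos)
  have x0: "x \<noteq> 0" using x by (simp add: eigenpair_def)
  then have s: "infnorm x > 0" by (simp add: infnorm_pos_lt)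
  obtain C where C: "C \<in> components_of_graph (D0 x) (induced_edges E (D0 x))" "card C \<ge> 2"
    using assms(4) by (auto simp: N_def card_gt_0_iff)
  obtain i j where ij: "i \<in> C" "j \<in> C" "i \<noteq> j" "{i, j} \<in> E"
    using component_has_edge[OF assms(1) C] by blast
  obtain c where c: "c \<in> D0 x" "C = (adjacency E (D0 x))\<^sup>* `` {c}"
    using C(1) by (auto simp: components_of_graph_induced)
  have sub: "C \<subseteq> D0 x" using c adjacency_stays by fastforce
  have closed: "l \<in> C" if "k \<in> C" "l \<in> D0 x" "{k, l} \<in> E" for k l
  proof -
    have "(k, l) \<in> adjacency E (D0 x)" using that sub by (auto simp: adjacency_def)
    then show ?thesis using that(1) c by (auto intro: rtrancl_into_rtrancl)
  qed
  obtain y where y: "critical E y" "y \<noteq> 0" "infnorm y = infnorm x" "D0 y = D0 x - C"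
    "total_variation E x < total_variation E y"
    by (rule raise_component[OF eigenpairD(1)[OF x] x0 sub ij]) (blast intro: closed)+
  have "eigenpair E (total_variation E y / (2 * vol E * infnorm y)) y"
    using y(1,2) vol by (rule critical_imp_eigenpair)
  moreover have "\<mu> < total_variation E y / (2 * vol E * infnorm y)"
    using y(3,5) eigenpairD(2)[OF x] s vol by (simp add: field_simps)
  \<comment> \<open>Every other large component keeps its vertex set, so at most one is
    lost.\<close>
  moreover have "?big (D0 x) - {C} \<subseteq> ?big (D0 y)"
    using components_of_graph_diff[OF C(1)] y(4) by auto
  then have "card (?big (D0 x) - {C}) \<le> N E y"
    unfolding N_def by (intro card_mono) auto
  then have "N E x \<le> Suc (N E y)"
    unfolding N_def[of E x] using C by (subst (asm) card_Diff_singleton) auto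
  ultimately show thesis using that by blast
qed

lemma N_eq_0_imp_no_edges:
  assumes "simple_graph E" and "N E x = 0"
  shows "induced_edges E (D0 x) = {}"
proof (rule ccontr)
  assume "induced_edges E (D0 x) \<noteq> {}"
  then obtain e where e: "e \<in> E" "e \<subseteq> D0 x" by (auto simp: induced_edges_def)
  then have "card e = 2" using assms(1) by (simp add: simple_graph_def)
  then obtain i j where ij: "e = {i, j}" "i \<noteq> j" by (auto simp: card_2_iff)
  let ?C = "(adjacency E (D0 x))\<^sup>* `` {i}"
  have "(i, j) \<in> adjacency E (D0 x)" using e ij by (auto simp: adjacency_def)
  then have "{i, j} \<subseteq> ?C" by auto
  then have "card {i, j} \<le> card ?C" by (intro card_mono) auto
  then have "?C \<in> {C \<in> components_of_graph (D0 x) (induced_edges E (D0 x)). card C \<ge> 2}"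
    using e ij by (auto simp: components_of_graph_induced)
  then show False using assms(2) by (auto simp: N_def)
qed

theorem theorem4p6:
  fixes E :: "'n::finite set set"
  assumes "simple_graph E" and "E \<noteq> {}"
  shows "finite (eigenvalues E) \<and> eigenvalues E \<noteq> {} \<and>
    (\<forall>(m::nat) (\<mu>::nat \<Rightarrow> real).
       strict_antimono_on {0..m} \<mu> \<and> \<mu> ` {0..m} = eigenvalues E \<longrightarrow>
         \<mu> m = 0 \<and>
         (\<forall>k\<in>{0..m}. \<forall>x. eigenpair E (\<mu> k) x \<longrightarrow> N E x \<le> k) \<and>
         (\<forall>x. eigenpair E (\<mu> 0) x \<longrightarrow> induced_edges E (D0 x) = {}))"
proof (intro conjI allI impI)
  have vol: "vol E > 0" using assms by (rule vol_pos)
  then show "finite (eigenvalues E)" by (rule finite_eigenvalues)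
  show "eigenvalues E \<noteq> {}" using zero_eigenvalue by blast
  fix m :: nat and \<mu> :: "nat \<Rightarrow> real"
  assume "strict_antimono_on {0..m} \<mu> \<and> \<mu> ` {0..m} = eigenvalues E"
  then have anti: "\<And>i j. i < j \<Longrightarrow> j \<le> m \<Longrightarrow> \<mu> j < \<mu> i" and im: "\<mu> ` {0..m} = eigenvalues E"
    by (auto simp: monotone_on_def)
  have le: "\<mu> m \<le> \<mu> i" if "i \<le> m" for i
    using anti[of i m] that by (cases "i = m") auto
  have nonneg: "\<mu> m \<ge> 0"
    using im by (intro eigenvalue_nonneg[OF _ vol]) auto
  obtain i where "i \<le> m" "\<mu> i = 0"
    using zero_eigenvalue[of E] unfolding im[symmetric] by auto
  with le[of i] nonneg show "\<mu> m = 0" by simp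
  have bound: "N E x \<le> k" if "k \<le> m" "eigenpair E (\<mu> k) x" for k x
    using that
  \<comment> \<open>Strong induction, because the larger eigenvalue need not be the next one in the
    list.\<close>
  proof (induction k arbitrary: x rule: less_induct)
    case (less k)
    show ?case
    proof (cases "N E x = 0")
      case False
      then obtain \<nu> y where y: "eigenpair E \<nu> y" "\<mu> k < \<nu>" "N E x \<le> Suc (N E y)"
        using larger_eigenvalue[OF assms less.prems(2)] by auto
      then have "\<nu> \<in> \<mu> ` {0..m}" unfolding im eigenvalues_def by blast
      then obtain j where j: "j \<le> m" "\<nu> = \<mu> j" by auto
      \<comment> \<open>The list decreases, so a larger eigenvalue has a smaller index; then
        \<open>N E x\<close> is at most \<open>Suc j\<close>, hence at most \<open>k\<close>. For
        \<open>k = 0\<close> this is the contradiction that excludes large components.\<close>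
      then have "j < k"
        using y(2) anti[of k j] by (cases j k rule: linorder_cases) auto
      with less.IH[of j y] y j show ?thesis by auto
    qed simp
  qed
  then show "\<forall>k\<in>{0..m}. \<forall>x. eigenpair E (\<mu> k) x \<longrightarrow> N E x \<le> k" by auto
  fix x assume "eigenpair E (\<mu> 0) x"
  then have "N E x = 0" using bound[of 0 x] by simp
  then show "induced_edges E (D0 x) = {}" by (rule N_eq_0_imp_no_edges[OF assms(1)])
qed

end
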